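(* Let $A$ be a dg algebra over a commutative ring $k$. Then two Maurer–Cartan elements of $A$ are strongly homotopic if and only if they are homotopy gauge equivalent.
   Context: A Maurer–Cartan element is $x\in A^1$ with $dx+x^2=0$. For such $x$, $A^{[x]}$ is the right dg $A$-module with underlying graded module $A$ and differential $a\mapsto da+xa$; $x,x'$ are homotopy gauge equivalent if $A^{[x]}$ and $A^{[x']}$ are homotopy equivalent right dg $A$-modules. Let $I$ be the singular simplicial set of $[0,1]$ and $I^*$ its normalized cochain algebra with values in $k$ (Alexander–Whitney product), a pseudo-compact dg algebra $I^*=\varprojlim I^*_\alpha$; $A\otimes I^*$ means the completed tensor product $\varprojlim_\alpha(A\otimes I^*_\alpha)$. $ev_0,ev_1:I^*\to k$ are restriction to the endpoints. Two MC elements $x_0,x_1$ are strongly homotopic if there is an MC element $X\in A\otimes I^*$ with $(\mathrm{id}_A\otimes ev_0)(X)=x_0$ and $(\mathrm{id}_A\otimes ev_1)(X)=x_1$. *)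

theory Defs
  imports "HOL-Analysis.Analysis" "HOL-Homology.Simplices"
begin

text \<open>A dg algebra A over k is modelled by its total space, a ring 'a (the direct sum of
 its homogeneous components), together with a k-action kact, the homogeneous components
 G n (n an integer) and the differential d of degree +1.\<close>

definition dg_algebra ::
  "('k::comm_ring_1 \<Rightarrow> 'a::ring_1 \<Rightarrow> 'a) \<Rightarrow> (int \<Rightarrow> 'a set) \<Rightarrow> ('a \<Rightarrow> 'a) \<Rightarrow> bool" where
  "dg_algebra kact G d \<longleftrightarrow>
     \<comment> \<open>k-algebra structure\<close>
     (\<forall>a. kact 1 a = a) \<and>
     (\<forall>r s a. kact (r * s) a = kact r (kact s a)) \<and>
     (\<forall>r s a. kact (r + s) a = kact r a + kact s a) \<and>
     (\<forall>r a b. kact r (a + b) = kact r a + kact r b) \<and>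
     (\<forall>r a b. kact r (a * b) = kact r a * b) \<and>
     (\<forall>r a b. kact r (a * b) = a * kact r b) \<and>
     \<comment> \<open>grading: each G n is a k-submodule, A is their direct sum\<close>
     (\<forall>n. 0 \<in> G n \<and> (\<forall>a\<in>G n. \<forall>b\<in>G n. a + b \<in> G n) \<and> (\<forall>r. \<forall>a\<in>G n. kact r a \<in> G n)) \<and>
     (\<forall>a. \<exists>!c :: int \<Rightarrow> 'a. finite {n. c n \<noteq> 0} \<and> (\<forall>n. c n \<in> G n) \<and>
              a = (\<Sum>n\<in>{n. c n \<noteq> 0}. c n)) \<and>
     (\<forall>p q. \<forall>a\<in>G p. \<forall>b\<in>G q. a * b \<in> G (p + q)) \<and>
     1 \<in> G 0 \<and>
     \<comment> \<open>differential: k-linear, degree +1, square zero, graded Leibniz rule\<close>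
     (\<forall>a b. d (a + b) = d a + d b) \<and>
     (\<forall>r a. d (kact r a) = kact r (d a)) \<and>
     (\<forall>n. \<forall>a\<in>G n. d a \<in> G (n + 1)) \<and>
     (\<forall>a. d (d a) = 0) \<and>
     (\<forall>p. \<forall>a\<in>G p. \<forall>b. d (a * b) = d a * b + (-1) ^ nat \<bar>p\<bar> * (a * d b))"

definition MC_element :: "(int \<Rightarrow> 'a::ring_1 set) \<Rightarrow> ('a \<Rightarrow> 'a) \<Rightarrow> 'a \<Rightarrow> bool" where
  "MC_element G d x \<longleftrightarrow> x \<in> G 1 \<and> d x + x * x = 0"

definition twisted_diff :: "('a::ring_1 \<Rightarrow> 'a) \<Rightarrow> 'a \<Rightarrow> 'a \<Rightarrow> 'a" where
  "twisted_diff d x a = d a + x * a"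

text \<open>A graded map of degree p between the underlying graded right A-modules of A^[x]
 and A^[y] (both with underlying graded module A): k-linear, of degree p, right A-linear.\<close>
definition graded_rmod_map ::
  "('k::comm_ring_1 \<Rightarrow> 'a::ring_1 \<Rightarrow> 'a) \<Rightarrow> (int \<Rightarrow> 'a set) \<Rightarrow> int \<Rightarrow> ('a \<Rightarrow> 'a) \<Rightarrow> bool" where
  "graded_rmod_map kact G p f \<longleftrightarrow>
     (\<forall>a b. f (a + b) = f a + f b) \<and>
     (\<forall>r a. f (kact r a) = kact r (f a)) \<and>
     (\<forall>n. \<forall>a\<in>G n. f a \<in> G (n + p)) \<and>
     (\<forall>m a. f (m * a) = f m * a)"

definition dg_rmod_morphism ::
  "('k::comm_ring_1 \<Rightarrow> 'a::ring_1 \<Rightarrow> 'a) \<Rightarrow> (int \<Rightarrow> 'a set) \<Rightarrow> ('a \<Rightarrow> 'a) \<Rightarrow> 'a \<Rightarrow> 'a \<Rightarrow> ('a \<Rightarrow> 'a) \<Rightarrow> bool" where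
  "dg_rmod_morphism kact G d x y f \<longleftrightarrow>
     graded_rmod_map kact G 0 f \<and> (\<forall>a. twisted_diff d y (f a) = f (twisted_diff d x a))"

definition homotopic_to_id ::
  "('k::comm_ring_1 \<Rightarrow> 'a::ring_1 \<Rightarrow> 'a) \<Rightarrow> (int \<Rightarrow> 'a set) \<Rightarrow> ('a \<Rightarrow> 'a) \<Rightarrow> 'a \<Rightarrow> ('a \<Rightarrow> 'a) \<Rightarrow> bool" where
  "homotopic_to_id kact G d x u \<longleftrightarrow>
     (\<exists>h. graded_rmod_map kact G (-1) h \<and>
          (\<forall>a. u a - a = twisted_diff d x (h a) + h (twisted_diff d x a)))"

definition homotopy_gauge_equivalent ::
  "('k::comm_ring_1 \<Rightarrow> 'a::ring_1 \<Rightarrow> 'a) \<Rightarrow> (int \<Rightarrow> 'a set) \<Rightarrow> ('a \<Rightarrow> 'a) \<Rightarrow> 'a \<Rightarrow> 'a \<Rightarrow> bool" where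
  "homotopy_gauge_equivalent kact G d x y \<longleftrightarrow>
     (\<exists>f g. dg_rmod_morphism kact G d x y f \<and> dg_rmod_morphism kact G d y x g \<and>
            homotopic_to_id kact G d x (g \<circ> f) \<and> homotopic_to_id kact G d y (f \<circ> g))"

definition unit_interval_top :: "real topology" where
  "unit_interval_top = subtopology euclideanreal {0..1}"

definition simplicial_degen :: "nat \<Rightarrow> (nat \<Rightarrow> real) \<Rightarrow> nat \<Rightarrow> real" where
  "simplicial_degen j x = (\<lambda>i. if i < j then x i else if i = j then x j + x (Suc j) else x (Suc i))"

definition degenerate_simplex :: "nat \<Rightarrow> ((nat \<Rightarrow> real) \<Rightarrow> real) \<Rightarrow> bool" where
  "degenerate_simplex n \<sigma> \<longleftrightarrow>
     (\<exists>m j \<tau>. n = Suc m \<and> j \<le> m \<and> singular_simplex m unit_interval_top \<tau> \<and>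
              \<sigma> = restrict (\<tau> \<circ> simplicial_degen j) (standard_simplex n))"

text \<open>Front i-face (vertices 0..i) and back j-face (vertices n-j..n) of an n-simplex.\<close>
definition front_face :: "nat \<Rightarrow> ((nat \<Rightarrow> real) \<Rightarrow> real) \<Rightarrow> (nat \<Rightarrow> real) \<Rightarrow> real" where
  "front_face i \<sigma> = restrict \<sigma> (standard_simplex i)"

definition back_face :: "nat \<Rightarrow> nat \<Rightarrow> ((nat \<Rightarrow> real) \<Rightarrow> real) \<Rightarrow> (nat \<Rightarrow> real) \<Rightarrow> real" where
  "back_face n j \<sigma> =
     restrict (\<sigma> \<circ> (\<lambda>x i. if n - j \<le> i then x (i - (n - j)) else 0)) (standard_simplex j)"

text \<open>Elements of the completed tensor product A \<otimes> I^* of total degree m, written as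
 A-valued normalized cochains: X n \<sigma> \<in> A^(m-n) for each singular n-simplex \<sigma>,
 vanishing on degenerate simplices.\<close>
definition normalized_cochain ::
  "(int \<Rightarrow> 'a::ring_1 set) \<Rightarrow> int \<Rightarrow> (nat \<Rightarrow> ((nat \<Rightarrow> real) \<Rightarrow> real) \<Rightarrow> 'a) \<Rightarrow> bool" where
  "normalized_cochain G m X \<longleftrightarrow>
     (\<forall>n \<sigma>. singular_simplex n unit_interval_top \<sigma> \<longrightarrow> X n \<sigma> \<in> G (m - int n)) \<and>
     (\<forall>n \<sigma>. degenerate_simplex n \<sigma> \<longrightarrow> X n \<sigma> = 0)"

text \<open>Differential of A \<otimes> I^* on an element of total degree m:
 d(a \<otimes> \<phi>) = da \<otimes> \<phi> + (-1)^|a| a \<otimes> \<delta>\<phi>, with \<delta>\<phi>(\<sigma>) = \<Sum>i (-1)^i \<phi>(\<partial>_i \<sigma>).\<close>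
definition tensor_diff ::
  "('a::ring_1 \<Rightarrow> 'a) \<Rightarrow> int \<Rightarrow> (nat \<Rightarrow> ((nat \<Rightarrow> real) \<Rightarrow> real) \<Rightarrow> 'a) \<Rightarrow> nat \<Rightarrow> ((nat \<Rightarrow> real) \<Rightarrow> real) \<Rightarrow> 'a" where
  "tensor_diff d m X n \<sigma> =
     d (X n \<sigma>) +
     (if n = 0 then 0
      else (-1) ^ nat \<bar>m - int n + 1\<bar> *
           (\<Sum>i\<le>n. (-1) ^ i * X (n - 1) (singular_face n i \<sigma>)))"

text \<open>Product of A \<otimes> I^* (Alexander-Whitney product on I^*, Koszul sign
 (a \<otimes> \<phi>)(b \<otimes> \<psi>) = (-1)^(|\<phi>||b|) ab \<otimes> \<phi>\<psi>), where Y has total degree m'.\<close>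
definition tensor_mult ::
  "int \<Rightarrow> (nat \<Rightarrow> ((nat \<Rightarrow> real) \<Rightarrow> real) \<Rightarrow> 'a::ring_1) \<Rightarrow> (nat \<Rightarrow> ((nat \<Rightarrow> real) \<Rightarrow> real) \<Rightarrow> 'a)
     \<Rightarrow> nat \<Rightarrow> ((nat \<Rightarrow> real) \<Rightarrow> real) \<Rightarrow> 'a" where
  "tensor_mult m' X Y n \<sigma> =
     (\<Sum>i\<le>n. (-1) ^ (i * nat \<bar>m' - int (n - i)\<bar>) *
               (X i (front_face i \<sigma>) * Y (n - i) (back_face n (n - i) \<sigma>)))"

definition point_simplex :: "real \<Rightarrow> (nat \<Rightarrow> real) \<Rightarrow> real" where
  "point_simplex p = restrict (\<lambda>_. p) (standard_simplex 0)"

definition strongly_homotopic ::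
  "(int \<Rightarrow> 'a::ring_1 set) \<Rightarrow> ('a \<Rightarrow> 'a) \<Rightarrow> 'a \<Rightarrow> 'a \<Rightarrow> bool" where
  "strongly_homotopic G d x0 x1 \<longleftrightarrow>
     (\<exists>X. normalized_cochain G 1 X \<and>
          (\<forall>n \<sigma>. singular_simplex n unit_interval_top \<sigma> \<longrightarrow>
                   tensor_diff d 1 X n \<sigma> + tensor_mult 1 X X n \<sigma> = 0) \<and>
          X 0 (point_simplex 0) = x0 \<and> X 0 (point_simplex 1) = x1)"

end

theory Submission
  imports Defs
begin

text \<open>
  An MC element of \<open>A \<otimes> I\<^sup>*\<close> assigns MC elements to points, closed maps \<open>1 + X\<close> between twisted
  modules to paths, homotopies to triangles and higher homotopies to the other simplices. Its
  values on the affine simplices \<open>(0,1)\<close>, \<open>(1,0)\<close>, \<open>(0,1,0)\<close> and \<open>(1,0,1)\<close> form a homotopy equivalence.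

  Conversely, label a point of the interval by whether it is \<open>0\<close>. It suffices to define the cochain on
  words in two letters, as a function of the labels of the vertices, and there only the alternating
  words are nondegenerate. The MC equation on alternating words is solved two words at a time: the
  word of length \<open>n\<close> starting at \<open>x\<close> together with its face starting at \<open>y\<close>. This pair of equations is
  a boundary problem in the cone of the homotopy equivalence from \<open>y\<close> to \<open>x\<close>, which is contractible,
  and the Bianchi identity says that the right-hand side is a cycle.
\<close>

lemma neg_one_power_mult: "(-1) ^ n * (z::'a::ring_1) = (if even n then z else - z)"
  by (simp add: minus_one_power_iff)

section \<open>Signs, degrees and the Leibniz rule in a dg algebra\<close>

locale dga =
  fixes kact :: "'k::comm_ring_1 \<Rightarrow> 'a::ring_1 \<Rightarrow> 'a"
    and G :: "int \<Rightarrow> 'a set" and d :: "'a \<Rightarrow> 'a"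
  assumes dg: "dg_algebra kact G d"
begin

lemma kact_one: "kact 1 a = a" 
  and kact_add_left: "kact (r + s) a = kact r a + kact s a" 
  and kact_mult: "kact r (a * b) = a * kact r b" 
  and zero_mem [simp]: "0 \<in> G n" 
  and add_mem: "a \<in> G n \<Longrightarrow> b \<in> G n \<Longrightarrow> a + b \<in> G n"
  and kact_mem: "a \<in> G n \<Longrightarrow> kact r a \<in> G n" 
  and one_mem [simp]: "1 \<in> G 0"
  and d_add: "d (a + b) = d a + d b" 
  and d_mem: "a \<in> G n \<Longrightarrow> d a \<in> G (n + 1)" 
  and d_d [simp]: "d (d a) = 0"
  using dg unfolding dg_algebra_def by metis+

lemma mult_mem: "a \<in> G p \<Longrightarrow> b \<in> G q \<Longrightarrow> p + q = r \<Longrightarrow> a * b \<in> G r" 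
  using dg unfolding dg_algebra_def by metis

lemma leibniz: "a \<in> G p \<Longrightarrow> d (a * b) = d a * b + (if even p then a * d b else - (a * d b))"
  using dg unfolding dg_algebra_def by (auto simp: even_nat_iff)

lemma d_zero [simp]: "d 0 = 0"
  using d_add [of 0 0] by simp

lemma d_minus: "d (- a) = - d a"
  using d_add [of a "- a"] by (simp add: eq_neg_iff_add_eq_0 add.commute)

lemma d_diff: "d (a - b) = d a - d b"
  using d_add [of a "- b"] by (simp add: d_minus)

lemma d_one [simp]: "d 1 = 0"
  using leibniz [of 1 0 1] by simp

lemma d_sum: "d (\<Sum>i\<in>I. f i) = (\<Sum>i\<in>I. d (f i))"
  by (induction I rule: infinite_finite_induct) (simp_all add: d_add)

lemma d_sign: "d ((-1) ^ n * a) = (-1) ^ n * d a"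
  by (simp add: neg_one_power_mult d_minus)

lemma minus_mem: "a \<in> G n \<Longrightarrow> - a \<in> G n"
proof -
  assume a: "a \<in> G n"
  have "kact 0 a = 0" 
    using kact_add_left [of 0 0 a] by simp
  then have "kact (-1) a = - a"
    using kact_add_left [of 1 "-1" a] by (simp add: kact_one eq_neg_iff_add_eq_0 add.commute)
  then show ?thesis 
    using kact_mem [OF a, of "-1"] by simp
qed

lemma diff_mem: "a \<in> G n \<Longrightarrow> b \<in> G n \<Longrightarrow> a - b \<in> G n"
  using add_mem minus_mem by (metis diff_conv_add_uminus)

lemma sign_mem: "a \<in> G n \<Longrightarrow> (-1) ^ k * a \<in> G n"
  by (simp add: neg_one_power_mult minus_mem)

lemma sum_mem: "(\<And>i. i \<in> I \<Longrightarrow> f i \<in> G n) \<Longrightarrow> (\<Sum>i\<in>I. f i) \<in> G n"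
  by (induction I rule: infinite_finite_induct) (auto simp: add_mem)

section \<open>Curvature of values on alternating words\<close>

text \<open>\<open>u v n\<close> is the value on the alternating word with \<open>n + 1\<close> letters and first letter \<open>v\<close>; its
  letter with index \<open>i\<close> is \<open>v = even i\<close>. The value on words of two letters is shifted by \<open>1\<close>
  (see \<open>word_cochain\<close>), which absorbs the two outer faces of every simplex; the only remaining
  trace is the constant for \<open>n = 2\<close>.\<close>

definition curv :: "(bool \<Rightarrow> nat \<Rightarrow> 'a) \<Rightarrow> bool \<Rightarrow> nat \<Rightarrow> 'a" where
  "curv u v n = d (u v n) + (\<Sum>i\<le>n. (-1) ^ (i * n) * (u v i * u (v = even i) (n - i)))
      - (if n = 2 then 1 else 0)"

lemma curv_mem:
  assumes "\<And>v i. u v i \<in> G (1 - int i)"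
  shows "curv u v n \<in> G (2 - int n)"
  unfolding curv_def
  using assms d_mem [OF assms[of v n]]
  by (intro diff_mem add_mem sum_mem sign_mem mult_mem [OF assms assms]) auto

text \<open>The Leibniz rule turns \<open>d\<close> of the quadratic part into terms in
  \<open>d u\<close>. Substituting for \<open>d u\<close> leaves the stated sum, triple products and
  unit terms. The triple products cancel by associativity; the unit terms cancel because the unit at
  index \<open>2\<close> contributes \<open>u v (n - 2)\<close> from either side.\<close>

lemma bianchi:
  assumes u: "\<And>v i. u v i \<in> G (1 - int i)"
  shows "d (curv u v n) = (\<Sum>i\<le>n. (-1) ^ (i * n) * 
     (curv u v i * u (v = even i) (n - i) - (-1) ^ i * (u v i * curv u (v = even i) (n - i))))"
proof -
  define P where "P v n = (\<Sum>i\<le>n. (-1) ^ (i * n) * (u v i * u (v = even i) (n - i)))" for v n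
  define \<delta> where "\<delta> n = (if n = 2 then 1 else 0 :: 'a)" for n :: nat
  have du: "d (u v i) = curv u v i - P v i + \<delta> i" for v i
    by (simp add: curv_def P_def \<delta>_def)
  have assoc: "(\<Sum>i\<le>n. (-1) ^ (i * n) * (P v i * u (v = even i) (n - i)))
     = (\<Sum>i\<le>n. (-1) ^ (i * n) * ((-1) ^ i * (u v i * P (v = even i) (n - i))))"
  proof -
    \<comment> \<open>Both sums run over the cuts of the word into three pieces,
      \<open>p + q + r = n\<close>; \<open>f\<close> carries the sign shared by the two
      bracketings.\<close>
    define f where "f p q r = (-1) ^ ((p + q) * n + (p + q) * p) * 
      (u v p * (u (v = even p) q * u (v = even (p + q)) r))" for p q r
    have "(-1) ^ (i * n) * (P v i * u (v = even i) (n - i)) = (\<Sum>p=0..i. f p (i - p) (n - i))"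
      if "i \<le> n" for i
      unfolding P_def sum_distrib_left sum_distrib_right atMost_atLeast0
      by (rule sum.cong) (auto simp: neg_one_power_mult f_def mult.assoc)
    moreover have "(-1) ^ (i * n) * ((-1) ^ i * (u v i * P (v = even i) (n - i)))
      = (\<Sum>q=0..n - i. f i q (n - i - q))" if "i \<le> n" for i
      unfolding P_def sum_distrib_left sum_distrib_right atMost_atLeast0
      using that by (intro sum.cong) (auto simp: neg_one_power_mult f_def mult.assoc)
    ultimately show ?thesis
      using fps_mult_assoc_lemma [where f = f and n = n and k = n]
      by (simp add: atMost_atLeast0)
  qed
  have unit: "(\<Sum>i\<le>n. (-1) ^ (i * n) * (\<delta> i * u (v = even i) (n - i)))
     = (\<Sum>i\<le>n. (-1) ^ (i * n) * ((-1) ^ i * (u v i * \<delta> (n - i))))"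
  proof (cases "n \<ge> 2")
    case True
    have "(\<Sum>i\<le>n. (-1) ^ (i * n) * (\<delta> i * u (v = even i) (n - i)))
        = (\<Sum>i\<le>n. if i = 2 then u v (n - 2) else 0)"
      by (rule sum.cong) (auto simp: neg_one_power_mult \<delta>_def)
    moreover have "(\<Sum>i\<le>n. (-1) ^ (i * n) * ((-1) ^ i * (u v i * \<delta> (n - i))))
        = (\<Sum>i\<le>n. if i = n - 2 then u v (n - 2) else 0)"
      using True by (intro sum.cong) (auto simp: neg_one_power_mult \<delta>_def)
    ultimately show ?thesis 
      using True by simp
  qed (auto simp: \<delta>_def intro!: sum.neutral)
  have "d (curv u v n) = (\<Sum>i\<le>n. (-1) ^ (i * n) * 
      (d (u v i) * u (v = even i) (n - i) - (-1) ^ i * (u v i * d (u (v = even i) (n - i)))))"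
    unfolding curv_def
    by (auto simp: neg_one_power_mult d_add d_diff d_sum d_minus leibniz [OF u] intro!: sum.cong)
  also have "\<dots> = (\<Sum>i\<le>n. (-1) ^ (i * n) * 
     (curv u v i * u (v = even i) (n - i) - (-1) ^ i * (u v i * curv u (v = even i) (n - i))))
   - ((\<Sum>i\<le>n. (-1) ^ (i * n) * (P v i * u (v = even i) (n - i)))
     - (\<Sum>i\<le>n. (-1) ^ (i * n) * ((-1) ^ i * (u v i * P (v = even i) (n - i)))))
   + ((\<Sum>i\<le>n. (-1) ^ (i * n) * (\<delta> i * u (v = even i) (n - i)))
     - (\<Sum>i\<le>n. (-1) ^ (i * n) * ((-1) ^ i * (u v i * \<delta> (n - i)))))"
    unfolding du sum_subtractf [symmetric] sum.distrib [symmetric]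
    by (rule sum.cong) (simp_all add: neg_one_power_mult algebra_simps)
  finally show ?thesis 
    using assoc unit by simp
qed

section \<open>Coherent extension of a homotopy equivalence\<close>

text \<open>The element \<open>Z\<close> below is the obstruction to extending \<open>F\<close>, \<open>g\<close>, \<open>H\<close>, \<open>K\<close> coherently; replacing \<open>S\<close>
  by \<open>T\<close> amounts to changing the homotopy \<open>H\<close> to \<open>H + g Z\<close>, which makes it a boundary.\<close>

lemma cone_solve:
  assumes mem: "F \<in> G 0" "g \<in> G 0" "H \<in> G (-1)" "K \<in> G (-1)" 
      "S \<in> G (2 - int n)" "R \<in> G (3 - int n)"
    and F: "d F + x * F = F * y" and g: "d g + y * g = g * x"
    and K: "F * g - 1 = d K + x * K + K * x" and H: "g * F - 1 = d H + y * H + H * y"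
    and S: "d S + x * S - (-1) ^ n * (S * z) = (-1) ^ n * (F * R)"
    and R: "d R + y * R + (-1) ^ n * (R * z) = 0"
  obtains a b where "a \<in> G (1 - int n)" "b \<in> G (2 - int n)"
    "R + (d b + y * b - (-1) ^ n * (b * z)) = 0"
    "S + (d a + x * a + (-1) ^ n * (a * z)) + (-1) ^ n * (F * b) = 0"
proof
  define Z where "Z = K * F - F * H"
  define T where "T = S - (-1) ^ n * (Z * R)"
  have Zm: "Z \<in> G (-1)"
    unfolding Z_def by (intro diff_mem mult_mem [OF mem(4,1)] mult_mem [OF mem(1,3)]) auto
  have Tm: "T \<in> G (2 - int n)"
    unfolding T_def by (intro diff_mem sign_mem mult_mem [OF Zm mem(6)] mem) auto
  \<comment> \<open>The witnesses follow the contraction of the cone: \<open>K\<close> and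
    \<open>H\<close> act on the two summands, and \<open>g\<close> maps from one to the
    other.\<close>
  show "K * T \<in> G (1 - int n)" 
    by (intro mult_mem [OF mem(4) Tm]) auto
  show "H * R - (-1) ^ n * (g * T) \<in> G (2 - int n)"
    by (intro diff_mem sign_mem mult_mem [OF mem(2) Tm] mult_mem [OF mem(3,6)]) auto
  have dF: "d F = F * y - x * F" and dg: "d g = g * x - y * g"
    and dK: "d K = F * g - 1 - x * K - K * x" and dH: "d H = g * F - 1 - y * H - H * y"
    and dR: "d R = - (y * R) - (-1) ^ n * (R * z)"
    and dS: "d S = (-1) ^ n * (F * R) - x * S + (-1) ^ n * (S * z)"
    using F g K H S R by (simp_all add: neg_one_power_mult algebra_simps eq_neg_iff_add_eq_0)
  \<comment> \<open>\<open>K * F\<close> and \<open>F * H\<close> both bound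
    \<open>F * g * F - F\<close> for the twisted differential, so \<open>Z\<close> is a cycle. Hence
    \<open>T\<close> satisfies the same equation as \<open>S\<close>.\<close>
  have dZ: "d Z = - (x * Z) - Z * y"
    unfolding Z_def d_diff leibniz [OF mem(1)] leibniz [OF mem(4)] dF dK dH
    by (simp add: neg_one_power_mult algebra_simps)
  have dT: "d T = (-1) ^ n * (F * R) - x * T + (-1) ^ n * (T * z)"
    unfolding T_def d_diff d_sign dS leibniz [OF Zm] dZ dR
    by (simp add: neg_one_power_mult algebra_simps)
  let ?b = "H * R - (-1) ^ n * (g * T)"
  show "R + (d ?b + y * ?b - (-1) ^ n * (?b * z)) = 0"
    unfolding d_diff d_sign leibniz [OF mem(2)] leibniz [OF mem(3)] dT dR dH dg
    by (simp add: neg_one_power_mult algebra_simps)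
  have ST: "S = T + (-1) ^ n * (K * F * R) - (-1) ^ n * (F * H * R)"
    unfolding T_def Z_def by (simp add: neg_one_power_mult algebra_simps)
  show "S + (d (K * T) + x * (K * T) + (-1) ^ n * (K * T * z)) + (-1) ^ n * (F * ?b) = 0"
    unfolding ST leibniz [OF mem(4)] dT dK
    by (simp add: neg_one_power_mult algebra_simps)
qed

text \<open>Only \<open>x\<close>, \<open>y\<close> and \<open>F\<close> are imposed as values;
  \<open>g\<close>, \<open>H\<close> and \<open>K\<close> enter through the contraction in
  \<open>cone_solve\<close>, which leaves room to correct \<open>H\<close>. Each stage adds
  \<open>u True (n + 2)\<close> and \<open>u False (n + 1)\<close> together.\<close>

lemma coherent_extension:
  assumes mem: "x \<in> G 1" "y \<in> G 1" "F \<in> G 0" "g \<in> G 0" "H \<in> G (-1)" "K \<in> G (-1)"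
    and x: "d x + x * x = 0" and y: "d y + y * y = 0"
    and F: "d F + x * F = F * y" and g: "d g + y * g = g * x"
    and K: "F * g - 1 = d K + x * K + K * x" and H: "g * F - 1 = d H + y * H + H * y"
  obtains u where "\<And>v i. u v i \<in> G (1 - int i)" "u True 0 = x" "u False 0 = y" 
    "\<And>v n. curv u v n = 0"
proof -
  \<comment> \<open>At stage \<open>n\<close> the values are settled up to index
    \<open>n + 1\<close> on \<open>True\<close> and \<open>n\<close> on \<open>False\<close>, with
    curvature zero in that range. Since all later values are zero, the next two curvatures are
    exactly the right-hand sides to be cancelled.\<close>
  define P where "P n u \<longleftrightarrow> (\<forall>v i. u v i \<in> G (1 - int i)) 
    \<and> u True 0 = x \<and> u False 0 = y \<and> u True 1 = F
    \<and> (\<forall>i<n + 2. curv u True i = 0) \<and> (\<forall>i<n + 1. curv u False i = 0)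
    \<and> (\<forall>i\<ge>n + 2. u True i = 0) \<and> (\<forall>i\<ge>n + 1. u False i = 0)" for n u
  define Q where "Q n u u' \<longleftrightarrow> (\<forall>i<n + 2. u' True i = u True i) \<and> (\<forall>i<n + 1. u' False i = u False i)"
    for n :: nat and u u' :: "bool \<Rightarrow> nat \<Rightarrow> 'a"
  have "\<exists>u. P 0 u"
  proof
    show "P 0 (\<lambda>v. if v then (\<lambda>_. 0)(0 := x, 1 := F) else (\<lambda>_. 0)(0 := y))"
      using mem x y F by (auto simp: P_def curv_def less_Suc_eq numeral_2_eq_2 algebra_simps)
  qed
  moreover have "\<exists>u'. P (Suc n) u' \<and> Q n u u'" if "P n u" for n u
  proof -
    have u: "\<And>v i. u v i \<in> G (1 - int i)" and u0: "u True 0 = x" "u False 0 = y" "u True 1 = F"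
      and cT: "\<And>i. i < n + 2 \<Longrightarrow> curv u True i = 0" and cF: "\<And>i. i < n + 1 \<Longrightarrow> curv u False i = 0"
      and zT: "\<And>i. i \<ge> n + 2 \<Longrightarrow> u True i = 0" and zF: "\<And>i. i \<ge> n + 1 \<Longrightarrow> u False i = 0"
      using that unfolding P_def by blast+
    have c: "curv u v i = 0" if "i < n + 1" for v i
      using cT cF that by (cases v) auto
    \<comment> \<open>Both words to be treated end in the letter \<open>even n\<close>, so a single
      \<open>z\<close> acts on the right in both equations.\<close>
    define S R z where "S = curv u True (n + 2)" and "R = curv u False (n + 1)" and "z = u (even n) 0"
    \<comment> \<open>All lower curvatures vanish, so the Bianchi sum retains only the terms that
      contain \<open>S\<close> or \<open>R\<close>.\<close>
    have "d S = (\<Sum>i\<le>n + 2. (if i = 0 then - (x * S) else 0) + (if i = 1 then (-1) ^ n * (F * R) else 0)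
        + (if i = n + 2 then (-1) ^ n * (S * z) else 0))"
      unfolding S_def bianchi [OF u]
    proof (rule sum.cong)
      fix i assume "i \<in> {..n + 2}"
      then consider "i = 0" | "i = 1" | "i = n + 2" | "2 \<le> i" "i < n + 2"
        by fastforce
      then show "(-1) ^ (i * (n + 2)) * (curv u True i * u (True = even i) (n + 2 - i)
           - (-1) ^ i * (u True i * curv u (True = even i) (n + 2 - i)))
        = (if i = 0 then - (x * curv u True (n + 2)) else 0) + (if i = 1 then (-1) ^ n * (F * R) else 0)
        + (if i = n + 2 then (-1) ^ n * (curv u True (n + 2) * z) else 0)"
        by cases (auto simp: u0 [simplified] cT c R_def z_def neg_one_power_mult)
    qed simp
    then have dS: "d S + x * S - (-1) ^ (n + 2) * (S * z) = (-1) ^ (n + 2) * (F * R)"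
      by (simp add: sum.distrib neg_one_power_mult)
    have "d R = (\<Sum>i\<le>n + 1. (if i = 0 then - (y * R) else 0) 
        + (if i = n + 1 then - ((-1) ^ n * (R * z)) else 0))"
      unfolding R_def bianchi [OF u]
    proof (rule sum.cong)
      fix i assume "i \<in> {..n + 1}"
      then consider "i = 0" | "i = n + 1" | "1 \<le> i" "i < n + 1"
        by fastforce
      then show "(-1) ^ (i * (n + 1)) * (curv u False i * u (False = even i) (n + 1 - i)
           - (-1) ^ i * (u False i * curv u (False = even i) (n + 1 - i)))
        = (if i = 0 then - (y * curv u False (n + 1)) else 0)
        + (if i = n + 1 then - ((-1) ^ n * (curv u False (n + 1) * z)) else 0)"
        by cases (auto simp: u0 c z_def neg_one_power_mult)
    qed simp
    then have dR: "d R + y * R + (-1) ^ (n + 2) * (R * z) = 0"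
      by (simp add: sum.distrib neg_one_power_mult)
    have "S \<in> G (2 - int (n + 2))" "R \<in> G (3 - int (n + 2))"
      using curv_mem [of u, OF u, of True "n + 2"] curv_mem [of u, OF u, of False "n + 1"] 
      by (simp_all add: S_def R_def algebra_simps)
    from cone_solve [OF mem(3-6) this F g K H dS dR]
    obtain a b where a: "a \<in> G (1 - int (n + 2))" and b: "b \<in> G (2 - int (n + 2))"
      and R': "R + (d b + y * b - (-1) ^ (n + 2) * (b * z)) = 0"
      and S': "S + (d a + x * a + (-1) ^ (n + 2) * (a * z)) + (-1) ^ (n + 2) * (F * b) = 0" .
    define u' where "u' = (\<lambda>v. if v then (u True)(n + 2 := a) else (u False)(n + 1 := b))"
    have Q: "u' True i = u True i" if "i < n + 2" for i
      using that by (auto simp: u'_def)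
    have Q': "u' False i = u False i" if "i < n + 1" for i
      using that by (auto simp: u'_def)
    have Q'': "u' v i = u v i" if "i < n + 1" for v i
      using that by (auto simp: u'_def)
    have u'_new: "u' True (n + 2) = a" "u' False (n + 1) = b" 
      by (auto simp: u'_def)
    have "curv u' v i = curv u v i" if "i < n + 1" for v i
      unfolding curv_def using that by (auto simp: Q'' intro!: sum.cong)
    then have c1: "curv u' v i = 0" if "i < n + 1" for v i
      using that c by simp
    \<comment> \<open>The new value \<open>b\<close> also has index \<open>n + 1\<close>, but a
      second factor of that index occurs only for \<open>i = 0\<close>, and then it starts with
      \<open>True\<close>.\<close>
    have "curv u' True (n + 1) = curv u True (n + 1)"
      unfolding curv_def 
    proof (intro arg_cong2 [where f = "(-)"] arg_cong2 [where f = "(+)"] sum.cong refl)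
      show "d (u' True (n + 1)) = d (u True (n + 1))"
        by (simp add: Q)
    next
      fix i assume i: "i \<in> {..n + 1}"
      then have "u' (True = even i) (n + 1 - i) = u (True = even i) (n + 1 - i)"
        by (cases "i = 0") (auto simp: Q Q'')
      then show "(-1) ^ (i * (n + 1)) * (u' True i * u' (True = even i) (n + 1 - i))
        = (-1) ^ (i * (n + 1)) * (u True i * u (True = even i) (n + 1 - i))"
        using i by (simp add: Q)
    qed 
    then have c2: "curv u' True (n + 1) = 0"
      by (simp add: cT)
    \<comment> \<open>The new value \<open>b\<close> enters only at the two ends of the sum.\<close>
    have "(\<Sum>i\<le>n + 1. (-1) ^ (i * (n + 1)) * (u' False i * u' (False = even i) (n + 1 - i)))
      = (\<Sum>i\<le>n + 1. (-1) ^ (i * (n + 1)) * (u False i * u (False = even i) (n + 1 - i))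
        + (if i = 0 then y * b else 0) + (if i = n + 1 then - ((-1) ^ n * (b * z)) else 0))"
    proof (rule sum.cong)
      fix i assume "i \<in> {..n + 1}"
      then consider "i = 0" | "i = n + 1" | "1 \<le> i" "i < n + 1"
        by fastforce
      then show "(-1) ^ (i * (n + 1)) * (u' False i * u' (False = even i) (n + 1 - i))
        = (-1) ^ (i * (n + 1)) * (u False i * u (False = even i) (n + 1 - i))
        + (if i = 0 then y * b else 0) + (if i = n + 1 then - ((-1) ^ n * (b * z)) else 0)"
        using u'_new by cases (auto simp: u0 Q'' z_def zF neg_one_power_mult)
    qed simp
    then have "curv u' False (n + 1) = R + (d b + y * b - (-1) ^ (n + 2) * (b * z))"
      using u'_new by (simp add: curv_def R_def sum.distrib neg_one_power_mult zF)
    then have c3: "curv u' False (n + 1) = 0"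
      using R' by simp
    \<comment> \<open>Here \<open>a\<close> enters at the two ends, and \<open>b\<close> only as the
      partner of \<open>F\<close> at \<open>i = 1\<close>.\<close>
    have "(\<Sum>i\<le>n + 2. (-1) ^ (i * (n + 2)) * (u' True i * u' (True = even i) (n + 2 - i)))
      = (\<Sum>i\<le>n + 2. (-1) ^ (i * (n + 2)) * (u True i * u (True = even i) (n + 2 - i))
        + (if i = 0 then x * a else 0) + (if i = 1 then (-1) ^ n * (F * b) else 0)
        + (if i = n + 2 then (-1) ^ n * (a * z) else 0))"
    proof (rule sum.cong)
      fix i assume "i \<in> {..n + 2}"
      then consider "i = 0" | "i = 1" | "i = n + 2" | "2 \<le> i" "i < n + 2"
        by fastforce
      then show "(-1) ^ (i * (n + 2)) * (u' True i * u' (True = even i) (n + 2 - i))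
        = (-1) ^ (i * (n + 2)) * (u True i * u (True = even i) (n + 2 - i))
        + (if i = 0 then x * a else 0) + (if i = 1 then (-1) ^ n * (F * b) else 0)
        + (if i = n + 2 then (-1) ^ n * (a * z) else 0)"
        using u'_new u0(3) by cases (auto simp: u0(1,2) Q Q'' z_def zT zF neg_one_power_mult)
    qed simp
    then have "curv u' True (n + 2) 
        = S + (d a + x * a + (-1) ^ (n + 2) * (a * z)) + (-1) ^ (n + 2) * (F * b)"
      using u'_new by (simp add: curv_def S_def sum.distrib neg_one_power_mult zT)
    then have c4: "curv u' True (n + 2) = 0"
      using S' by simp
    have "u' v i \<in> G (1 - int i)" for v i
      using u [of v i] a b by (auto simp: u'_def)
    moreover have "u' True 0 = x" "u' False 0 = y" "u' True 1 = F"
      using u0 by (simp_all add: Q Q')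
    moreover have "curv u' True i = 0" if "i < Suc n + 2" for i
      using c1 c2 c4 that by (metis Suc_1 add_Suc add_Suc_right less_Suc_eq add.commute plus_1_eq_Suc)
    moreover have "curv u' False i = 0" if "i < Suc n + 1" for i
      using c1 c3 that by (metis add.commute less_Suc_eq plus_1_eq_Suc)
    moreover have "u' True i = 0" if "i \<ge> Suc n + 2" for i
      using zT that by (auto simp: u'_def)
    moreover have "u' False i = 0" if "i \<ge> Suc n + 1" for i
      using zF that by (auto simp: u'_def)
    ultimately have "P (Suc n) u'"
      unfolding P_def by blast
    moreover have "Q n u u'"
      using Q Q' by (auto simp: Q_def)
    ultimately show ?thesis by blast
  qed
  ultimately obtain U where U: "\<And>n. P n (U n)" "\<And>n. Q n (U n) (U (Suc n))"
    using dependent_nat_choice [of P Q] by metis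
  \<comment> \<open>By \<open>Q\<close> later stages keep the settled values, so the diagonal is a
    limit of the stages.\<close>
  define u where "u v i = U i v i" for v i
  have stable: "U (i + k) v i = u v i" for i k v
  proof (induction k)
    case (Suc k)
    then show ?case
      using U(2) [of "i + k"] by (cases v) (auto simp: Q_def)
  qed (simp add: u_def)
  have agree: "U n v i = u v i" if "i \<le> n" for i n v
    using stable [of i "n - i" v] that by simp
  have curv: "curv u v n = curv (U n) v n" for v n
    unfolding curv_def by (simp add: agree)
  show ?thesis
  proof (rule that [of u])
    show "u v i \<in> G (1 - int i)" for v i
      using U(1) [of i] unfolding P_def u_def by blast
    show "u True 0 = x" "u False 0 = y"
      using U(1) [of 0] unfolding P_def u_def by blast+
    have "curv (U n) True n = 0" "curv (U n) False n = 0" for n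
      using U(1) [of n] unfolding P_def by simp_all
    then show "curv u v n = 0" for v n
      unfolding curv by (cases v) simp_all
  qed
qed

section \<open>Maurer-Cartan cochains on words in two letters\<close>

text \<open>The shift on words of two letters is undone here. A word that is not alternating repeats
  a letter, so normalization dictates the value zero.\<close>

definition word_cochain :: "(bool \<Rightarrow> nat \<Rightarrow> 'a) \<Rightarrow> nat \<Rightarrow> (nat \<Rightarrow> bool) \<Rightarrow> 'a" where
  "word_cochain u n w = 
     (if \<forall>j\<le>n. w j = (w 0 = even j) then u (w 0) n - (if n = 1 then 1 else 0) else 0)"

lemma word_cochain_cong:
  assumes "\<And>j. j \<le> n \<Longrightarrow> w j = w' j"
  shows "word_cochain u n w = word_cochain u n w'"
proof -
  have w0: "w 0 = w' 0"
    using assms by simp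
  have "(\<forall>j\<le>n. w j = (w 0 = even j)) = (\<forall>j\<le>n. w' j = (w' 0 = even j))"
    unfolding w0 using assms by blast
  then show ?thesis
    unfolding word_cochain_def by (simp only: w0)
qed

lemma word_cochain_repeat:
  assumes "j < n" "w j = w (Suc j)"
  shows "word_cochain u n w = 0"
proof -
  have "w j \<noteq> (w 0 = even j) \<or> w (Suc j) \<noteq> (w 0 = even (Suc j))"
    using assms by auto
  then show ?thesis
    using assms unfolding word_cochain_def by (metis less_imp_le Suc_leI)
qed

lemma word_cochain_mem:
  assumes "\<And>v i. u v i \<in> G (1 - int i)"
  shows "word_cochain u n w \<in> G (1 - int n)"
proof -
  have "u (w 0) n - (if n = 1 then 1 else 0) \<in> G (1 - int n)"
    using assms [of "w 0" n] by (auto intro!: diff_mem)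
  then show ?thesis
    unfolding word_cochain_def using zero_mem by (simp only: split: if_split) blast
qed

text \<open>If a letter is repeated, all products vanish and the two faces that delete one of the
  equal letters cancel. On an alternating word only the outer faces survive, and they cancel against
  the cross terms produced by the shift, which leaves \<open>curv\<close>.\<close>

lemma word_cochain_MC:
  assumes curv: "\<And>v n. curv u v n = 0"
  shows "d (word_cochain u n w) 
    + (if n = 0 then 0 else (-1) ^ n *
        (\<Sum>i\<le>n. (-1) ^ i * word_cochain u (n - 1) (\<lambda>j. w (if j < i then j else Suc j))))
    + (\<Sum>i\<le>n. (-1) ^ (i * n) * (word_cochain u i w * word_cochain u (n - i) (\<lambda>j. w (i + j)))) = 0"
    (is "_ + (if n = 0 then 0 else _ * (\<Sum>i\<le>n. ?face i)) + ?prod = 0")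
proof (cases "\<forall>j\<le>n. w j = (w 0 = even j)")
  case False
  then obtain j where j: "j < n" "w j = w (Suc j)"
  proof -
    have "w j = (w 0 = even j)" if "\<forall>j<n. w j \<noteq> w (Suc j)" "j \<le> n" for j
      using that by (induction j) auto
    then show ?thesis 
      using False that by blast
  qed
  have face0: "?face i = 0" if "i < j \<or> i > Suc j" "i \<le> n" for i
  proof -
    have "word_cochain u (n - 1) (\<lambda>j. w (if j < i then j else Suc j)) = 0"
      by (rule word_cochain_repeat [of "if i < j then j - 1 else j"]) (use that j in \<open>auto\<close>)
    then show ?thesis by simp
  qed
  have "(\<Sum>i\<le>n. ?face i) = (\<Sum>i\<in>{j, Suc j}. ?face i)"
  proof (intro sum.mono_neutral_right ballI)
    fix i assume "i \<in> {..n} - {j, Suc j}"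
    then have "i < j \<or> i > Suc j" "i \<le> n" by auto
    then show "?face i = 0" by (rule face0)
  qed (use j in auto)
  moreover have "(\<lambda>k. w (if k < Suc j then k else Suc k)) = (\<lambda>k. w (if k < j then k else Suc k))"
    using j(2) by (simp add: fun_eq_iff less_Suc_eq)
  then have "(\<Sum>i\<in>{j, Suc j}. ?face i) = 0"
    by (simp add: neg_one_power_mult)
  ultimately have "(\<Sum>i\<le>n. ?face i) = 0"
    by (rule trans)
  \<comment> \<open>A cut leaves the repeated pair entirely in the front or entirely in the back
    piece.\<close>
  moreover have "?prod = 0"
  proof (intro sum.neutral ballI)
    fix i assume "i \<in> {..n}"
    show "(-1) ^ (i * n) * (word_cochain u i w * word_cochain u (n - i) (\<lambda>j. w (i + j))) = 0"
    proof (cases "Suc j \<le> i")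
      case True
      then show ?thesis
        using j word_cochain_repeat [of j i w] by simp
    next
      case False
      then show ?thesis
        using j word_cochain_repeat [of "j - i" "n - i" "\<lambda>j. w (i + j)"] by simp
    qed
  qed
  moreover have "word_cochain u n w = 0"
    using False unfolding word_cochain_def by (rule if_not_P)
  ultimately show ?thesis by simp
next
  case True
  define v where "v = w 0"
  have w: "w j = (v = even j)" if "j \<le> n" for j
    using True that unfolding v_def by blast
  have wc: "word_cochain u i w = u v i - (if i = 1 then 1 else 0)" if "i \<le> n" for i
  proof -
    have "\<forall>j\<le>i. w j = (w 0 = even j)"
      using True that le_trans by blast
    then show ?thesis
      unfolding word_cochain_def v_def by (rule if_P)
  qed
  have wc': "word_cochain u k (\<lambda>j. w (i + j)) = u (v = even i) k - (if k = 1 then 1 else 0)" 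
    if "i + k \<le> n" for i k
  proof -
    have wi: "w (i + 0) = (v = even i)"
      using w that by simp
    have "\<forall>j\<le>k. w (i + j) = (w (i + 0) = even j)"
      unfolding wi using w that by auto
    then show ?thesis
      unfolding word_cochain_def wi [symmetric] by (rule if_P)
  qed
  let ?one = "if n = 1 then 1 else 0 :: 'a" and ?two = "if n = 2 then 1 else 0 :: 'a"
  \<comment> \<open>The cross terms of the two shifts sit at \<open>i = 1\<close> and
    \<open>i = n - 1\<close>; both shifts meet only for \<open>n = 2\<close>, which gives
    \<open>?two\<close>. A second \<open>?two\<close> then comes from the constant in
    \<open>curv\<close>.\<close>
  have "?prod = (\<Sum>i\<le>n. (-1) ^ (i * n) * (u v i * u (v = even i) (n - i))
      - (if i = 1 then (-1) ^ n * u (\<not> v) (n - 1) else 0) 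
      - (if Suc i = n then u v (n - 1) else 0)
      + (if i = 1 then ?two else 0))"
  proof (rule sum.cong)
    fix i assume i: "i \<in> {..n}"
    have r: "word_cochain u i w = u v i - (if i = 1 then 1 else 0)"
      "word_cochain u (n - i) (\<lambda>j. w (i + j)) = u (v = even i) (n - i) - (if n - i = 1 then 1 else 0)"
      by (rule wc wc', use i in simp)+
    show "(-1) ^ (i * n) * (word_cochain u i w * word_cochain u (n - i) (\<lambda>j. w (i + j)))
      = (-1) ^ (i * n) * (u v i * u (v = even i) (n - i))
      - (if i = 1 then (-1) ^ n * u (\<not> v) (n - 1) else 0) 
      - (if Suc i = n then u v (n - 1) else 0)
      + (if i = 1 then ?two else 0)"
      unfolding r using i by (auto simp: neg_one_power_mult algebra_simps)
  qed simp
  also have "\<dots> = (\<Sum>i\<le>n. (-1) ^ (i * n) * (u v i * u (v = even i) (n - i)))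
      - (if n = 0 then 0 else (-1) ^ n * u (\<not> v) (n - 1) + u v (n - 1)) + ?two"
    by (cases n) (auto simp: sum.distrib sum_subtractf)
  also have "\<dots> = - d (u v n) - (if n = 0 then 0 else (-1) ^ n * u (\<not> v) (n - 1) + u v (n - 1)) + ?two + ?two"
    using curv [of v n] by (simp add: curv_def algebra_simps)
  finally have prod: "?prod = \<dots>" .
  \<comment> \<open>Deleting an inner letter makes two equal letters adjacent. For
    \<open>n = 2\<close> both outer faces are words of two letters, and their shifts cancel the two
    copies of \<open>?two\<close> in \<open>prod\<close>.\<close>
  have faces: "(-1) ^ n * (\<Sum>i\<le>n. ?face i) = (-1) ^ n * u (\<not> v) (n - 1) + u v (n - 1) - ?two - ?two" if "n > 0"
  proof -
    have face0: "?face i = 0" if "i \<noteq> 0" "i \<noteq> n" "i \<le> n" for i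
    proof -
      have "word_cochain u (n - 1) (\<lambda>j. w (if j < i then j else Suc j)) = 0"
        by (rule word_cochain_repeat [of "i - 1"]) (use that w in \<open>auto\<close>)
      then show ?thesis by simp
    qed
    have "(\<Sum>i\<le>n. ?face i) = (\<Sum>i\<in>{0, n}. ?face i)"
    proof (intro sum.mono_neutral_right ballI)
      fix i assume "i \<in> {..n} - {0, n}"
      then show "?face i = 0" by (intro face0) auto
    qed auto
    also have "\<dots> = ?face 0 + ?face n"
      using that by simp
    also have "word_cochain u (n - 1) (\<lambda>j. w (if j < n then j else Suc j)) = word_cochain u (n - 1) w"
      using that by (intro word_cochain_cong) auto
    also have "word_cochain u (n - 1) w = u v (n - 1) - ?two"
      using that by (subst wc) auto
    also have "(\<lambda>j. w (if j < 0 then j else Suc j)) = (\<lambda>j. w (1 + j))"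
      by simp
    also have "word_cochain u (n - 1) (\<lambda>j. w (1 + j)) = u (\<not> v) (n - 1) - ?two"
      using that by (subst wc') auto
    finally show ?thesis
      by (simp add: neg_one_power_mult)
  qed
  have dw: "d (word_cochain u n w) = d (u v n)"
    by (simp add: wc d_diff)
  show ?thesis
  proof (cases "n = 0")
    case True
    show ?thesis
      unfolding dw prod using True by simp
  next
    case False
    then have "n > 0" by simp
    show ?thesis
      unfolding dw prod faces [OF \<open>n > 0\<close>] using False by simp
  qed
qed

section \<open>Homotopy gauge equivalence as equations between elements\<close>

text \<open>As a right module \<open>A\<close> is free on \<open>1\<close>, so module maps become
  elements of \<open>A\<close>.\<close>

lemma graded_rmod_map_eq_mult:
  assumes "graded_rmod_map kact G p f"
  shows "f = (*) (f 1)" "f 1 \<in> G p"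
proof -
  have "f a = f 1 * a" for a
    using assms mult_1_left [of a] unfolding graded_rmod_map_def by metis
  then show "f = (*) (f 1)" by blast
  show "f 1 \<in> G p"
    using assms one_mem unfolding graded_rmod_map_def by fastforce
qed

lemma graded_rmod_map_mult:
  assumes "c \<in> G p"
  shows "graded_rmod_map kact G p ((*) c)"
  unfolding graded_rmod_map_def
  using mult_mem [OF assms] by (auto simp: algebra_simps kact_mult)

lemma dg_rmod_morphism_mult_iff:
  assumes "c \<in> G 0"
  shows "dg_rmod_morphism kact G d x y ((*) c) \<longleftrightarrow> d c + y * c = c * x"
proof -
  \<comment> \<open>By the Leibniz rule the defect is left multiplication by an element, so it
    vanishes as soon as it vanishes at \<open>1\<close>.\<close>
  have "twisted_diff d y (c * a) - c * twisted_diff d x a = (d c + y * c - c * x) * a" for a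
    using leibniz [OF assms, of a] by (simp add: twisted_diff_def algebra_simps)
  then have "(\<forall>a. twisted_diff d y (c * a) = c * twisted_diff d x a)
      \<longleftrightarrow> (\<forall>a. (d c + y * c - c * x) * a = 0)"
    by (metis eq_iff_diff_eq_0)
  also have "\<dots> \<longleftrightarrow> d c + y * c = c * x"
    by (metis eq_iff_diff_eq_0 mult_1_right mult_zero_left)
  finally show ?thesis
    using graded_rmod_map_mult [OF assms] by (simp add: dg_rmod_morphism_def)
qed

lemma homotopic_to_id_mult_iff:
  "homotopic_to_id kact G d x ((*) c) \<longleftrightarrow> (\<exists>h\<in>G (-1). c - 1 = d h + x * h + h * x)"
proof -
  have eq: "c * a - a - (twisted_diff d x (h * a) + h * twisted_diff d x a)
      = (c - 1 - (d h + x * h + h * x)) * a" if "h \<in> G (-1)" for a h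
    using leibniz [OF that, of a] by (simp add: twisted_diff_def algebra_simps)
  have *: "(\<forall>a. c * a - a = twisted_diff d x (h * a) + h * twisted_diff d x a)
      \<longleftrightarrow> c - 1 = d h + x * h + h * x" if "h \<in> G (-1)" for h
  proof -
    have "(\<forall>a. c * a - a = twisted_diff d x (h * a) + h * twisted_diff d x a)
      \<longleftrightarrow> (\<forall>a. (c - 1 - (d h + x * h + h * x)) * a = 0)"
      using eq [OF that] by (metis eq_iff_diff_eq_0)
    also have "\<dots> \<longleftrightarrow> c - 1 = d h + x * h + h * x"
      by (metis eq_iff_diff_eq_0 mult_1_right mult_zero_left)
    finally show ?thesis .
  qed
  show ?thesis
  proof
    assume "homotopic_to_id kact G d x ((*) c)"
    then obtain h where h: "graded_rmod_map kact G (-1) h"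
      "\<forall>a. c * a - a = twisted_diff d x (h a) + h (twisted_diff d x a)"
      unfolding homotopic_to_id_def by blast
    note hm = graded_rmod_map_eq_mult [OF h(1)]
    have "\<forall>a. c * a - a = twisted_diff d x (h 1 * a) + h 1 * twisted_diff d x a"
      using h(2) hm(1) by metis
    then show "\<exists>h\<in>G (-1). c - 1 = d h + x * h + h * x"
      using * hm(2) by blast
  next
    assume "\<exists>h\<in>G (-1). c - 1 = d h + x * h + h * x"
    then show "homotopic_to_id kact G d x ((*) c)"
      using * graded_rmod_map_mult unfolding homotopic_to_id_def by blast
  qed
qed

lemma homotopy_gauge_equivalent_iff:
  "homotopy_gauge_equivalent kact G d x y \<longleftrightarrow>
    (\<exists>f\<in>G 0. \<exists>g\<in>G 0. d f + y * f = f * x \<and> d g + x * g = g * y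
      \<and> (\<exists>h\<in>G (-1). g * f - 1 = d h + x * h + h * x)
      \<and> (\<exists>k\<in>G (-1). f * g - 1 = d k + y * k + k * y))"
proof -
  have comp: "(*) f \<circ> (*) g = (*) (f * g)" for f g :: 'a
    by (auto simp: mult.assoc)
  show ?thesis
  proof
    assume "homotopy_gauge_equivalent kact G d x y"
    then obtain f g where fg: "dg_rmod_morphism kact G d x y f" "dg_rmod_morphism kact G d y x g"
      "homotopic_to_id kact G d x (g \<circ> f)" "homotopic_to_id kact G d y (f \<circ> g)"
      unfolding homotopy_gauge_equivalent_def by blast
    have "graded_rmod_map kact G 0 f" "graded_rmod_map kact G 0 g"
      using fg unfolding dg_rmod_morphism_def by blast+
    note * = graded_rmod_map_eq_mult [OF this(1)] graded_rmod_map_eq_mult [OF this(2)]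
    then obtain f' g' where f': "f = (*) f'" "f' \<in> G 0" and g': "g = (*) g'" "g' \<in> G 0"
      by blast
    show "\<exists>f\<in>G 0. \<exists>g\<in>G 0. d f + y * f = f * x \<and> d g + x * g = g * y
      \<and> (\<exists>h\<in>G (-1). g * f - 1 = d h + x * h + h * x)
      \<and> (\<exists>k\<in>G (-1). f * g - 1 = d k + y * k + k * y)"
      using fg f'(2) g'(2) unfolding f'(1) g'(1) comp homotopic_to_id_mult_iff
        dg_rmod_morphism_mult_iff [OF f'(2)] dg_rmod_morphism_mult_iff [OF g'(2)]
      by blast
  next
    assume "\<exists>f\<in>G 0. \<exists>g\<in>G 0. d f + y * f = f * x \<and> d g + x * g = g * y
      \<and> (\<exists>h\<in>G (-1). g * f - 1 = d h + x * h + h * x)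
      \<and> (\<exists>k\<in>G (-1). f * g - 1 = d k + y * k + k * y)"
    then obtain f g where fg: "f \<in> G 0" "g \<in> G 0" "d f + y * f = f * x" "d g + x * g = g * y"
      "\<exists>h\<in>G (-1). g * f - 1 = d h + x * h + h * x"
      "\<exists>k\<in>G (-1). f * g - 1 = d k + y * k + k * y"
      by blast
    show "homotopy_gauge_equivalent kact G d x y"
      unfolding homotopy_gauge_equivalent_def
    proof (intro exI conjI)
      show "dg_rmod_morphism kact G d x y ((*) f)" "dg_rmod_morphism kact G d y x ((*) g)"
        using fg by (simp_all only: dg_rmod_morphism_mult_iff)
      show "homotopic_to_id kact G d x ((*) g \<circ> (*) f)" "homotopic_to_id kact G d y ((*) f \<circ> (*) g)"
        unfolding comp homotopic_to_id_mult_iff by (fact fg)+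
    qed
  qed
qed

end

section \<open>Vertices and affine simplices\<close>

definition vertex :: "nat \<Rightarrow> nat \<Rightarrow> real" where
  "vertex i = (\<lambda>j. if j = i then 1 else 0)"

lemma vertex_in_standard_simplex [simp]: "vertex i \<in> standard_simplex p \<longleftrightarrow> i \<le> p"
  by (simp add: vertex_def)

lemma front_face_vertex: "j \<le> i \<Longrightarrow> front_face i \<sigma> (vertex j) = \<sigma> (vertex j)"
  by (simp add: front_face_def)

lemma back_face_vertex:
  assumes "j \<le> k"
  shows "back_face n k \<sigma> (vertex j) = \<sigma> (vertex (n - k + j))"
proof -
  have "(\<lambda>i. if n - k \<le> i then vertex j (i - (n - k)) else 0) = vertex (n - k + j)"
    by (auto simp: vertex_def fun_eq_iff)
  then show ?thesis
    using assms by (simp add: back_face_def)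
qed

lemma singular_face_vertex:
  assumes "j \<le> n - 1"
  shows "singular_face n k \<sigma> (vertex j) = \<sigma> (vertex (if j < k then j else Suc j))"
proof -
  have "simplical_face k (vertex j) = vertex (if j < k then j else Suc j)"
    by (auto simp: vertex_def simplical_face_def fun_eq_iff)
  then show ?thesis
    using assms by (simp add: singular_face_def)
qed

text \<open>A degeneracy merges two neighbouring vertices. Thus the label word of a degenerate
  simplex has a repeated letter, which gives normalization.\<close>

lemma degenerate_simplex_vertex:
  assumes "degenerate_simplex n \<sigma>"
  obtains j where "j < n" "\<sigma> (vertex j) = \<sigma> (vertex (Suc j))"
proof -
  obtain m j \<tau> where *: "n = Suc m" "j \<le> m" "\<sigma> = restrict (\<tau> \<circ> simplicial_degen j) (standard_simplex n)"
    using assms unfolding degenerate_simplex_def by blast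
  have "simplicial_degen j (vertex j) = vertex j" "simplicial_degen j (vertex (Suc j)) = vertex j"
    by (auto simp: simplicial_degen_def vertex_def fun_eq_iff)
  with * show ?thesis
    by (intro that [of j]) auto
qed

lemma point_simplex_vertex [simp]: "point_simplex p (vertex 0) = p"
  by (simp add: point_simplex_def)

definition affine_simplex :: "nat \<Rightarrow> (nat \<Rightarrow> real) \<Rightarrow> (nat \<Rightarrow> real) \<Rightarrow> real" where
  "affine_simplex n c = restrict (\<lambda>x. \<Sum>i\<le>n. c i * x i) (standard_simplex n)"

lemma singular_simplex_affine:
  assumes "\<And>i. c i \<in> {0..1}"
  shows "singular_simplex n unit_interval_top (affine_simplex n c)"
proof -
  have "(\<Sum>i\<le>n. c i * x i) \<in> {0..1}" if "x \<in> standard_simplex n" for x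
  proof -
    have x: "\<And>i. 0 \<le> x i" "(\<Sum>i\<le>n. x i) = 1"
      using that by (auto simp: standard_simplex_def)
    have "(\<Sum>i\<le>n. c i * x i) \<le> (\<Sum>i\<le>n. x i)"
      using assms x(1) by (intro sum_mono mult_left_le_one_le) auto
    moreover have "0 \<le> (\<Sum>i\<le>n. c i * x i)"
      using assms x(1) by (intro sum_nonneg mult_nonneg_nonneg) auto
    ultimately show ?thesis
      using x(2) by simp
  qed
  moreover have "continuous_map (subtopology (powertop_real UNIV) (standard_simplex n)) euclideanreal
      (\<lambda>x. \<Sum>i\<le>n. c i * x i)"
    by (intro continuous_map_sum continuous_map_real_mult continuous_map_from_subtopology
        continuous_map_product_projection) auto
  then have "continuous_map (subtopology (powertop_real UNIV) (standard_simplex n)) euclideanreal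
      (affine_simplex n c)"
    by (rule continuous_map_eq) (simp add: affine_simplex_def)
  ultimately show ?thesis
    unfolding singular_simplex_def unit_interval_top_def
    by (auto simp: continuous_map_in_subtopology affine_simplex_def)
qed

lemma affine_simplex_cong:
  "(\<And>i. i \<le> n \<Longrightarrow> c i = c' i) \<Longrightarrow> affine_simplex n c = affine_simplex n c'"
  unfolding affine_simplex_def by (intro restrict_ext sum.cong) auto

lemma affine_simplex_0: "affine_simplex 0 c = point_simplex (c 0)"
  unfolding affine_simplex_def point_simplex_def
  by (intro restrict_ext) (simp add: standard_simplex_0)

lemma front_face_affine:
  assumes "k \<le> n"
  shows "front_face k (affine_simplex n c) = affine_simplex k c"
  unfolding front_face_def affine_simplex_def
proof (intro restrict_ext)
  fix x assume x: "x \<in> standard_simplex k"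
  have "(\<Sum>i\<le>n. c i * x i) = (\<Sum>i\<le>k. c i * x i)"
    using x assms by (intro sum.mono_neutral_right) (auto simp: standard_simplex_def)
  moreover have "x \<in> standard_simplex n"
    using x standard_simplex_mono [OF assms] by blast
  ultimately show "(\<lambda>x\<in>standard_simplex n. \<Sum>i\<le>n. c i * x i) x = (\<Sum>i\<le>k. c i * x i)"
    by simp
qed

lemma back_face_affine:
  assumes "k \<le> n"
  shows "back_face n k (affine_simplex n c) = affine_simplex k (\<lambda>i. c (n - k + i))"
  unfolding back_face_def affine_simplex_def
proof (intro restrict_ext)
  fix x assume x: "x \<in> standard_simplex k"
  let ?y = "\<lambda>i. if n - k \<le> i then x (i - (n - k)) else 0"
  have sum: "(\<Sum>i\<le>n. c i * ?y i) = (\<Sum>i\<le>k. c (n - k + i) * x i)" for c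
  proof -
    have "(\<Sum>i\<le>n. c i * ?y i) = (\<Sum>i\<in>{n - k..n}. c i * ?y i)"
      by (intro sum.mono_neutral_right) auto
    also have "\<dots> = (\<Sum>i\<le>k. c (n - k + i) * x i)"
      by (rule sum.reindex_bij_witness [of _ "\<lambda>i. n - k + i" "\<lambda>i. i - (n - k)"]) 
        (use assms in auto)
    finally show ?thesis .
  qed
  have "?y \<in> standard_simplex n"
    using x sum [of "\<lambda>_. 1"] assms by (auto simp: standard_simplex_def)
  then show "((\<lambda>x\<in>standard_simplex n. \<Sum>i\<le>n. c i * x i) \<circ> (\<lambda>x i. if n - k \<le> i then x (i - (n - k)) else 0)) x
      = (\<Sum>i\<le>k. c (n - k + i) * x i)"
    by (simp add: sum [symmetric])
qed

lemma singular_face_affine: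
  assumes "1 \<le> n" "k \<le> n"
  shows "singular_face n k (affine_simplex n c) 
    = affine_simplex (n - 1) (\<lambda>i. c (if i < k then i else Suc i))"
  unfolding singular_face_def affine_simplex_def One_nat_def
proof (intro restrict_ext)
  fix x assume x: "x \<in> standard_simplex (n - Suc 0)"
  have "(\<Sum>i\<le>n. c i * simplical_face k x i) = (\<Sum>i\<in>{..n} - {k}. c i * simplical_face k x i)"
    by (intro sum.mono_neutral_right) (auto simp: simplical_face_def)
  also have "\<dots> = (\<Sum>i\<le>n - Suc 0. c (if i < k then i else Suc i) * x i)"
    by (rule sum.reindex_bij_witness 
        [of _ "\<lambda>i. if i < k then i else Suc i" "\<lambda>i. if i < k then i else i - 1"]) 
      (use assms in \<open>auto simp: simplical_face_def split: if_splits\<close>)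
  finally have "(\<Sum>i\<le>n. c i * simplical_face k x i) = \<dots>" .
  then show "((\<lambda>x\<in>standard_simplex n. \<Sum>i\<le>n. c i * x i) \<circ> simplical_face k) x
      = (\<Sum>i\<le>n - Suc 0. c (if i < k then i else Suc i) * x i)"
    using simplical_face_in_standard_simplex [OF assms x] by simp
qed

text \<open>The middle face of the triangle \<open>(p,q,p)\<close> is this constant edge, so a
  normalized cochain vanishes on it.\<close>

lemma degenerate_edge:
  assumes "p \<in> {0..1}"
  shows "degenerate_simplex 1 (affine_simplex 1 (\<lambda>_. p))"
proof -
  have "affine_simplex 1 (\<lambda>_. p) = restrict (point_simplex p \<circ> simplicial_degen 0) (standard_simplex 1)"
    unfolding affine_simplex_def
  proof (intro restrict_ext)
    fix x assume x: "x \<in> standard_simplex 1"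
    then have "simplicial_degen 0 x \<in> standard_simplex 0"
      by (auto simp: standard_simplex_def simplicial_degen_def)
    then show "(\<Sum>i\<le>1. p * x i) = (point_simplex p \<circ> simplicial_degen 0) x"
      using x by (simp add: point_simplex_def standard_simplex_def sum_distrib_left [symmetric])
  qed
  moreover have "singular_simplex 0 unit_interval_top (point_simplex p)"
    using singular_simplex_affine [of "\<lambda>_. p" 0] assms by (simp add: affine_simplex_0)
  ultimately show ?thesis
    unfolding degenerate_simplex_def by (metis One_nat_def le0)
qed

section \<open>Signs in total degree one\<close>

lemma tensor_diff_degree_1:
  fixes X :: "nat \<Rightarrow> ((nat \<Rightarrow> real) \<Rightarrow> real) \<Rightarrow> 'a::ring_1"
  shows "tensor_diff d 1 X n \<sigma> = d (X n \<sigma>) + (if n = 0 then 0 else (-1) ^ n * 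
     (\<Sum>i\<le>n. (-1) ^ i * X (n - 1) (singular_face n i \<sigma>)))"
proof -
  have "(-1) ^ nat \<bar>1 - int n + 1\<bar> = ((-1) ^ n :: 'a)"
    by (simp add: minus_one_power_iff even_nat_iff)
  then show ?thesis
    unfolding tensor_diff_def by (simp only:)
qed

lemma tensor_mult_degree_1:
  fixes X Y :: "nat \<Rightarrow> ((nat \<Rightarrow> real) \<Rightarrow> real) \<Rightarrow> 'a::ring_1"
  shows "tensor_mult 1 X Y n \<sigma> = (\<Sum>i\<le>n. (-1) ^ (i * n) * 
     (X i (front_face i \<sigma>) * Y (n - i) (back_face n (n - i) \<sigma>)))"
proof -
  \<comment> \<open>The two exponents agree modulo \<open>2\<close> because
    \<open>i * (i + 1)\<close> is even.\<close>
  have "(-1) ^ (i * nat \<bar>1 - int (n - i)\<bar>) = ((-1) ^ (i * n) :: 'a)" if "i \<le> n" for i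
    using that by (auto simp: minus_one_power_iff even_nat_iff)
  then show ?thesis
    unfolding tensor_mult_def by (intro sum.cong) (simp_all only: atMost_iff)
qed

section \<open>The two implications\<close>

context dga begin

lemma gauge_imp_strongly_homotopic:
  assumes x: "MC_element G d x" and y: "MC_element G d y"
    and "homotopy_gauge_equivalent kact G d x y"
  shows "strongly_homotopic G d x y"
proof -
  obtain f g h k where mem: "f \<in> G 0" "g \<in> G 0" "h \<in> G (-1)" "k \<in> G (-1)"
    and f: "d f + y * f = f * x" and g: "d g + x * g = g * y"
    and h: "g * f - 1 = d h + x * h + h * x" and k: "f * g - 1 = d k + y * k + k * y"
    using assms(3) unfolding homotopy_gauge_equivalent_iff by blast
  have x': "x \<in> G 1" "d x + x * x = 0" and y': "y \<in> G 1" "d y + y * y = 0"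
    using x y by (simp_all add: MC_element_def)
  \<comment> \<open>\<open>coherent_extension\<close> expects \<open>F\<close> to go from
    \<open>y\<close> to \<open>x\<close>, so \<open>g\<close> takes the role of \<open>F\<close>,
    \<open>f\<close> that of \<open>g\<close>, \<open>k\<close> that of \<open>H\<close> and
    \<open>h\<close> that of \<open>K\<close>.\<close>
  obtain u where u: "\<And>v i. u v i \<in> G (1 - int i)" "u True 0 = x" "u False 0 = y" 
      "\<And>v n. curv u v n = 0"
    using coherent_extension [OF x'(1) y'(1) mem(2,1,4,3) x'(2) y'(2) g f h k] by blast
  \<comment> \<open>Cochains are arbitrary functions on singular simplices, so this discontinuous
    labelling of vertices is allowed; \<open>0\<close> gets the letter \<open>True\<close> of
    \<open>x\<close>, and \<open>1\<close> the letter \<open>False\<close> of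
    \<open>y\<close>.\<close>
  define X where "X n \<sigma> = word_cochain u n (\<lambda>j. \<sigma> (vertex j) = (0::real))" for n \<sigma>
  have face: "X (n - 1) (singular_face n i \<sigma>) 
      = word_cochain u (n - 1) (\<lambda>j. \<sigma> (vertex (if j < i then j else Suc j)) = 0)" for n i \<sigma>
    unfolding X_def by (intro word_cochain_cong) (simp add: singular_face_vertex)
  have front_f: "X i (front_face i \<sigma>) = word_cochain u i (\<lambda>j. \<sigma> (vertex j) = 0)" for i \<sigma>
    unfolding X_def by (intro word_cochain_cong) (simp add: front_face_vertex)
  have back_f: "X (n - i) (back_face n (n - i) \<sigma>) 
      = word_cochain u (n - i) (\<lambda>j. \<sigma> (vertex (i + j)) = 0)" if "i \<le> n" for n i \<sigma>
    unfolding X_def using that by (intro word_cochain_cong) (simp add: back_face_vertex)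
  have "tensor_diff d 1 X n \<sigma> + tensor_mult 1 X X n \<sigma> = 0" for n \<sigma>
  proof -
    have "tensor_mult 1 X X n \<sigma> = (\<Sum>i\<le>n. (-1) ^ (i * n) * (word_cochain u i (\<lambda>j. \<sigma> (vertex j) = 0)
        * word_cochain u (n - i) (\<lambda>j. \<sigma> (vertex (i + j)) = 0)))"
      unfolding tensor_mult_degree_1 front_f by (intro sum.cong) (auto simp: back_f)
    then show ?thesis
      using word_cochain_MC [of u n "\<lambda>j. \<sigma> (vertex j) = 0", OF u(4)]
      unfolding tensor_diff_degree_1 face by (simp add: X_def)
  qed
  moreover have "normalized_cochain G 1 X"
    unfolding normalized_cochain_def
  proof (intro conjI allI impI)
    show "X n \<sigma> \<in> G (1 - int n)" for n \<sigma>
      unfolding X_def by (rule word_cochain_mem [OF u(1)])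
  next
    fix n \<sigma> assume "degenerate_simplex n \<sigma>"
    then obtain j where "j < n" "\<sigma> (vertex j) = \<sigma> (vertex (Suc j))"
      by (rule degenerate_simplex_vertex)
    then show "X n \<sigma> = 0"
      unfolding X_def by (intro word_cochain_repeat [of j n]) metis+
  qed
  moreover have "X 0 (point_simplex 0) = x" "X 0 (point_simplex 1) = y"
    using u(2,3) by (simp_all add: X_def word_cochain_def)
  ultimately show ?thesis
    unfolding strongly_homotopic_def by blast
qed

lemma strongly_homotopic_imp_gauge:
  assumes "strongly_homotopic G d x y"
  shows "homotopy_gauge_equivalent kact G d x y"
proof -
  obtain X where X: "normalized_cochain G 1 X"
    and MC: "\<And>n \<sigma>. singular_simplex n unit_interval_top \<sigma> \<Longrightarrow>
          tensor_diff d 1 X n \<sigma> + tensor_mult 1 X X n \<sigma> = 0"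
    and ends: "X 0 (point_simplex 0) = x" "X 0 (point_simplex 1) = y"
    using assms unfolding strongly_homotopic_def by blast
  define D where "D n c = X n (affine_simplex n c)" for n c
  have D0: "D 0 c = X 0 (point_simplex (c 0))" for c
    by (simp add: D_def affine_simplex_0)
  have D_cong: "D n c = D n c'" if "\<And>i. i \<le> n \<Longrightarrow> c i = c' i" for n c c'
    unfolding D_def using affine_simplex_cong [of n c c'] that by simp
  have D_mem: "D n c \<in> G (1 - int n)" if "\<And>i. c i \<in> {0..1}" for n c
    using X singular_simplex_affine [of c, OF that] unfolding D_def normalized_cochain_def by blast
  have D_MC: "d (D n c) + (if n = 0 then 0 else (-1) ^ n * 
        (\<Sum>i\<le>n. (-1) ^ i * D (n - 1) (\<lambda>j. c (if j < i then j else Suc j))))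
      + (\<Sum>i\<le>n. (-1) ^ (i * n) * (D i c * D (n - i) (\<lambda>j. c (i + j)))) = 0"
    if "\<And>i. c i \<in> {0..1}" for n c
    using MC [OF singular_simplex_affine, of c n, OF that]
    by (cases n) (simp_all add: tensor_diff_degree_1 tensor_mult_degree_1 D_def 
        singular_face_affine front_face_affine back_face_affine)
  define a where "a p q = D 1 (\<lambda>i. if i = 0 then p else q)" for p q
  define t where "t p q = D 2 (\<lambda>i. if i = 1 then q else p)" for p q
  define z where "z p = X 0 (point_simplex p)" for p
  have a_mem: "a p q \<in> G 0" if "p \<in> {0..1}" "q \<in> {0..1}" for p q
    using D_mem [of "\<lambda>i. if i = 0 then p else q" 1] that by (simp add: a_def)
  have t_mem: "t p q \<in> G (-1)" if "p \<in> {0..1}" "q \<in> {0..1}" for p q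
    using D_mem [of "\<lambda>i. if i = 1 then q else p" 2] that by (simp add: t_def)
  \<comment> \<open>On an edge the boundary terms \<open>z p\<close> and \<open>z q\<close> are
    absorbed by the unit, so \<open>1 + a p q\<close> is a closed map from \<open>z q\<close> to
    \<open>z p\<close>.\<close>
  have a: "d (1 + a p q) + z p * (1 + a p q) = (1 + a p q) * z q" 
    if "p \<in> {0..1}" "q \<in> {0..1}" for p q
    using D_MC [of "\<lambda>i. if i = 0 then p else q" 1] that
    by (simp add: a_def z_def D0 d_add algebra_simps)
  \<comment> \<open>On the triangle \<open>(p,q,p)\<close> the two nondegenerate faces and the
    product of edges combine to \<open>(1 + a p q) * (1 + a q p) - 1\<close>; the remaining terms
    make \<open>- t p q\<close> the homotopy.\<close>
  have t: "(1 + a p q) * (1 + a q p) - 1 = d (- t p q) + z p * (- t p q) + (- t p q) * z p" 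
    if "p \<in> {0..1}" "q \<in> {0..1}" for p q
  proof -
    have "D 1 (\<lambda>_. p) = 0"
      using X degenerate_edge [OF that(1)] unfolding D_def normalized_cochain_def by blast
    moreover have "D 1 (\<lambda>j. if (if j < 1 then j else Suc j) = 1 then q else p) = D 1 (\<lambda>_. p)"
      "D 1 (\<lambda>j. if (if j < 2 then j else Suc j) = 1 then q else p) = a p q"
      "D 1 (\<lambda>j. if (if j < 0 then j else Suc j) = 1 then q else p) = a q p"
      "D 1 (\<lambda>j. if j = 1 then q else p) = a p q"
      "D 1 (\<lambda>j. if 1 + j = 1 then q else p) = a q p"
      unfolding a_def by (intro D_cong; force simp: le_Suc_eq)+
    ultimately show ?thesis
      using D_MC [of "\<lambda>i. if i = 1 then q else p" 2] that
      by (simp add: numeral_2_eq_2 t_def z_def D0 d_minus eq_neg_iff_add_eq_0 algebra_simps)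
  qed
  have "z 0 = x" "z 1 = y"
    using ends by (simp_all add: z_def)
  then show ?thesis
    unfolding homotopy_gauge_equivalent_iff
    using a [of 0 1] a [of 1 0] t [of 0 1] t [of 1 0]
    \<comment> \<open>The map from \<open>x\<close> to \<open>y\<close> is \<open>1 + a 1 0\<close>,
      since \<open>a p q\<close> runs from its second argument to its first.\<close>
    by (intro bexI [of _ "1 + a 1 0"] bexI [of _ "1 + a 0 1"] conjI bexI [of _ "- t 0 1"] bexI [of _ "- t 1 0"]
        add_mem minus_mem a_mem t_mem) simp_all
qed

end

theorem theorem5p8:
  fixes kact :: "'k::comm_ring_1 \<Rightarrow> 'a::ring_1 \<Rightarrow> 'a"
    and G :: "int \<Rightarrow> 'a set" and d :: "'a \<Rightarrow> 'a" and x y :: 'a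
  assumes "dg_algebra kact G d"
    and "MC_element G d x" and "MC_element G d y"
  shows "strongly_homotopic G d x y \<longleftrightarrow> homotopy_gauge_equivalent kact G d x y"
proof -
  interpret dga kact G d
    by unfold_locales (fact assms(1))
  show ?thesis
    using assms(2,3) gauge_imp_strongly_homotopic strongly_homotopic_imp_gauge by blast
qed

end
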